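(* Let $(G,p)$ be a framework in $\mathbb{R}^d$ with distinct framework points, with graph $G=(V,E)$ and rigidity matrix $R(G,p)$. (i) Let $T$ be an isometry of $\mathbb{R}^d$ which effects a spatial symmetry of $(G,p)$ with associated graph automorphism $\sigma$, so that $p_{\sigma(i)}=Tp_i$ for all $i$. Let $\sigma_v$ and $\sigma_e$ be the induced permutation transformations of $\mathcal{H}_v$ and $\mathcal{H}_e$, let $S$ be the linear isometry factor (linear part) of $T$, and let $\tilde S=S\oplus\dots\oplus S$ be the induced operator on $\mathcal{H}_v$. Then $$R(G,p)=\sigma_e^{-1}R(G,p)\,\sigma_v\tilde S .$$ (ii) Let $\mathcal{G}$ be the spatial symmetry group of $(G,p)$, with representation $\hat\rho_v=\rho_n\otimes\rho_{sp}$ on $\mathcal{H}_v$ and representation $\rho_e$ on $\mathcal{H}_e$. Then, for all $g\in\mathcal{G}$, $$R(G,p)=\rho_e(g^{-1})\,R(G,p)\,\hat\rho_v(g).$$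
   Context: A framework $(G,p)$ in $\mathbb{R}^d$ consists of a finite connected simple graph $G=(V,E)$ with ordered vertices $v_1,\dots,v_n$ and edges $e_1,\dots,e_m$, and a vector $p=(p_1,\dots,p_n)$ of points $p_i\in\mathbb{R}^d$. Set $\mathcal{H}_v=\bigoplus_{k=1}^n\mathbb{R}^d=\mathbb{R}^n\otimes\mathbb{R}^d$ (one copy of $\mathbb{R}^d$ per vertex) and $\mathcal{H}_e=\bigoplus_{k=1}^m\mathbb{R}=\mathbb{R}^m$ (one copy of $\mathbb{R}$ per edge), with standard bases. The rigidity matrix $R(G,p)$ is the $m\times dn$ real matrix, viewed as a linear map $\mathcal{H}_v\to\mathcal{H}_e$, whose row for the edge $e=(v_i,v_j)$ has the entries of the row vector $p_i-p_j$ in the $d$ columns of $v_i$, the entries of $p_j-p_i$ in the $d$ columns of $v_j$, and zeros elsewhere. A graph automorphism $\sigma$ is regarded as a permutation of $\{1,\dots,n\}$, with $\sigma(v_i)=v_{\sigma(i)}$, and also acts on edges. The transformation $\sigma_e$ of $\mathcal{H}_e$ sends the basis vector of an edge $f$ to that of $\sigma(f)$. The transformation $\sigma_v$ of $\mathcal{H}_v$ sends the basis vector for vertex $v_i$ and a given coordinate direction to the basis vector for $v_{\sigma(i)}$ and the same coordinate direction. A spatial symmetry of $(G,p)$ is a graph automorphism $\sigma$ effected by an isometry $T$ of $\mathbb{R}^d$, in the sense that $p_{\sigma(i)}=Tp_i$ for all $i$. The spatial symmetry group $\mathcal{G}$ is the group of all such $g=(\sigma,T)$ under composition. For $g=(\sigma,T)\in\mathcal{G}$: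 $\rho_e(g)=\sigma_e$; $\rho_n(g)$ is the permutation matrix on $\mathbb{R}^n$ sending the $i$-th basis vector to the $\sigma(i)$-th; $\rho_{sp}(g)$ is the linear part $S\in O(d)$ of $T$; and $\hat\rho_v(g)=\rho_n(g)\otimes\rho_{sp}(g)=\sigma_v\tilde S$. *)

theory Defs
  imports
    "HOL-Combinatorics.Permutations"
    "HOL-Library.FuncSet"
    "HOL-Algebra.Group"
    "Jordan_Normal_Form.Determinant"
    "Jordan_Normal_Form.Gauss_Jordan_Elimination"
begin

text \<open>
  Everything is indexed from 0: the vertices are the numbers below \<open>n\<close>, the edges are the entries of
  a duplicate-free list \<open>es\<close> of two-element vertex sets, and \<open>\<real>\<^sup>d\<close> is \<^term>\<open>carrier_vec d :: real vec set\<close>.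
  The basis vector of \<open>\<H>\<^sub>v\<close> for vertex \<open>i\<close> and coordinate \<open>k\<close> has index \<open>i * d + k\<close>,
  and that of \<open>\<H>\<^sub>e\<close> for the edge \<open>es ! r\<close> has index \<open>r\<close>. Linear maps are given by their matrices.
\<close>

definition simple_graph :: "nat \<Rightarrow> nat set list \<Rightarrow> bool" where
  "simple_graph n es \<longleftrightarrow>
     distinct es \<and> (\<forall>e\<in>set es. \<exists>i j. i < n \<and> j < n \<and> i \<noteq> j \<and> e = {i, j})"

definition connected_graph :: "nat \<Rightarrow> nat set list \<Rightarrow> bool" where
  "connected_graph n es \<longleftrightarrow>
     n > 0 \<and> (\<forall>i<n. \<forall>j<n. (i, j) \<in> {(a, b). {a, b} \<in> set es}\<^sup>*)"

definition framework :: "nat \<Rightarrow> nat \<Rightarrow> nat set list \<Rightarrow> (nat \<Rightarrow> real vec) \<Rightarrow> bool" where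
  "framework d n es p \<longleftrightarrow>
     simple_graph n es \<and> connected_graph n es \<and> (\<forall>i<n. p i \<in> carrier_vec d)"

text \<open>
  In the row of an edge \<open>e\<close>, the columns of an endpoint \<open>v\<close> hold \<open>p v - p w\<close>, where \<open>w\<close> is the other
  endpoint. This is unaffected by the order in which the endpoints of \<open>e\<close> are listed.
\<close>

definition rigidity_matrix :: "nat \<Rightarrow> nat \<Rightarrow> nat set list \<Rightarrow> (nat \<Rightarrow> real vec) \<Rightarrow> real mat" where
  "rigidity_matrix d n es p = mat (length es) (n * d) (\<lambda>(r, c).
     let e = es ! r; v = c div d; k = c mod d
     in if v \<in> e then (p v - p (THE w. e = {v, w})) $ k else 0)"

definition graph_automorphism :: "nat \<Rightarrow> nat set list \<Rightarrow> (nat \<Rightarrow> nat) \<Rightarrow> bool" where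
  "graph_automorphism n es \<sigma> \<longleftrightarrow>
     \<sigma> permutes {..<n} \<and> (\<forall>i<n. \<forall>j<n. {\<sigma> i, \<sigma> j} \<in> set es \<longleftrightarrow> {i, j} \<in> set es)"

definition edge_perm_mat :: "nat set list \<Rightarrow> (nat \<Rightarrow> nat) \<Rightarrow> real mat" where
  "edge_perm_mat es \<sigma> = mat (length es) (length es) (\<lambda>(r, c).
     if es ! r = \<sigma> ` (es ! c) then 1 else 0)"

definition vertex_perm_mat :: "nat \<Rightarrow> nat \<Rightarrow> (nat \<Rightarrow> nat) \<Rightarrow> real mat" where
  "vertex_perm_mat d n \<sigma> = mat (n * d) (n * d) (\<lambda>(r, c).
     if r div d = \<sigma> (c div d) \<and> r mod d = c mod d then 1 else 0)"

definition vec_dist :: "real vec \<Rightarrow> real vec \<Rightarrow> real" where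
  "vec_dist x y = sqrt ((x - y) \<bullet> (x - y))"

definition isometry :: "nat \<Rightarrow> (real vec \<Rightarrow> real vec) \<Rightarrow> bool" where
  "isometry d T \<longleftrightarrow> T \<in> carrier_vec d \<rightarrow> carrier_vec d \<and>
     (\<forall>x\<in>carrier_vec d. \<forall>y\<in>carrier_vec d. vec_dist (T x) (T y) = vec_dist x y)"

definition linear_part :: "nat \<Rightarrow> (real vec \<Rightarrow> real vec) \<Rightarrow> real mat" where
  "linear_part d T = (THE S. S \<in> carrier_mat d d \<and>
     (\<exists>b\<in>carrier_vec d. \<forall>x\<in>carrier_vec d. T x = S *\<^sub>v x + b))"

text \<open>The direct sum of \<open>n\<close> copies of \<open>S\<close>, as an operator on \<open>\<H>\<^sub>v\<close>.\<close>

definition direct_sum_mat :: "nat \<Rightarrow> real mat \<Rightarrow> real mat" where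
  "direct_sum_mat n S = diag_block_mat (replicate n S)"

definition spatial_symmetry ::
  "nat \<Rightarrow> nat \<Rightarrow> nat set list \<Rightarrow> (nat \<Rightarrow> real vec) \<Rightarrow> (nat \<Rightarrow> nat) \<Rightarrow> (real vec \<Rightarrow> real vec) \<Rightarrow> bool" where
  "spatial_symmetry d n es p \<sigma> T \<longleftrightarrow>
     graph_automorphism n es \<sigma> \<and> isometry d T \<and> (\<forall>i<n. p (\<sigma> i) = T (p i))"

text \<open>
  Inside the group the isometries are extensional on \<^term>\<open>carrier_vec d :: real vec set\<close>, so that
  equality of group elements is equality of isometries of \<open>\<real>\<^sup>d\<close>.
\<close>

definition spatial_symmetry_group ::
  "nat \<Rightarrow> nat \<Rightarrow> nat set list \<Rightarrow> (nat \<Rightarrow> real vec) \<Rightarrow> ((nat \<Rightarrow> nat) \<times> (real vec \<Rightarrow> real vec)) monoid" where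
  "spatial_symmetry_group d n es p =
     \<lparr>carrier = {(\<sigma>, T). spatial_symmetry d n es p \<sigma> T \<and> T \<in> extensional (carrier_vec d)},
      mult = (\<lambda>(\<sigma>, T) (\<tau>, U). (\<sigma> \<circ> \<tau>, compose (carrier_vec d) T U)),
      one = (id, \<lambda>x\<in>carrier_vec d. x)\<rparr>"

definition kronecker :: "real mat \<Rightarrow> real mat \<Rightarrow> real mat" where
  "kronecker A B = mat (dim_row A * dim_row B) (dim_col A * dim_col B) (\<lambda>(r, c).
     A $$ (r div dim_row B, c div dim_col B) * B $$ (r mod dim_row B, c mod dim_col B))"

definition rho_e :: "nat set list \<Rightarrow> (nat \<Rightarrow> nat) \<times> (real vec \<Rightarrow> real vec) \<Rightarrow> real mat" where
  "rho_e es g = edge_perm_mat es (fst g)"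

definition rho_n :: "nat \<Rightarrow> (nat \<Rightarrow> nat) \<times> (real vec \<Rightarrow> real vec) \<Rightarrow> real mat" where
  "rho_n n g = mat n n (\<lambda>(r, c). if r = fst g c then 1 else 0)"

definition rho_sp :: "nat \<Rightarrow> (nat \<Rightarrow> nat) \<times> (real vec \<Rightarrow> real vec) \<Rightarrow> real mat" where
  "rho_sp d g = linear_part d (snd g)"

definition rho_v_hat :: "nat \<Rightarrow> nat \<Rightarrow> (nat \<Rightarrow> nat) \<times> (real vec \<Rightarrow> real vec) \<Rightarrow> real mat" where
  "rho_v_hat d n g = kronecker (rho_n n g) (rho_sp d g)"

lemma scalar_prod_self_nonneg: "(x :: real vec) \<bullet> x \<ge> 0"
  by (auto simp: scalar_prod_def intro!: sum_nonneg)

lemma vec_dist_eq_iff: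
  "vec_dist x y = vec_dist x' y' \<longleftrightarrow> (x - y) \<bullet> (x - y) = (x' - y') \<bullet> (x' - y')"
  by (simp add: vec_dist_def)

lemma scalar_prod_diff_self:
  assumes "(x :: real vec) \<in> carrier_vec d" "y \<in> carrier_vec d"
  shows "(x - y) \<bullet> (x - y) = x \<bullet> x - 2 * (x \<bullet> y) + y \<bullet> y"
proof -
  have "(x - y) \<bullet> (x - y) = x \<bullet> x - x \<bullet> y - (y \<bullet> x - y \<bullet> y)"
    using assms
    by (simp add: minus_scalar_prod_distrib[of _ d] scalar_prod_minus_distrib[of _ d])
  moreover have "y \<bullet> x = x \<bullet> y"
    using assms by (rule_tac comm_scalar_prod[of _ d])
  ultimately show ?thesis by simp
qed

lemma isometry_affine:
  assumes T: "isometry d T"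
  obtains S b where "S \<in> carrier_mat d d" "b \<in> carrier_vec d"
    "transpose_mat S * S = 1\<^sub>m d" "S * transpose_mat S = 1\<^sub>m d"
    "\<And>x. x \<in> carrier_vec d \<Longrightarrow> T x = S *\<^sub>v x + b"
proof -
  define f where "f x = T x - T (0\<^sub>v d)" for x
  have Tc: "T x \<in> carrier_vec d" if "x \<in> carrier_vec d" for x
    using T that by (auto simp: isometry_def)
  have fc: "f x \<in> carrier_vec d" if "x \<in> carrier_vec d" for x
    using Tc[OF that] Tc[of "0\<^sub>v d"] by (auto simp: f_def)
  have dist: "(f x - f y) \<bullet> (f x - f y) = (x - y) \<bullet> (x - y)"
    if xy: "x \<in> carrier_vec d" "y \<in> carrier_vec d" for x y
  proof -
    have "f x - f y = T x - T y"
      using Tc[OF xy(1)] Tc[OF xy(2)] Tc[of "0\<^sub>v d"] by (intro eq_vecI) (auto simp: f_def)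
    then show ?thesis
      using T xy by (auto simp: isometry_def vec_dist_eq_iff)
  qed
  have f0: "f (0\<^sub>v d) = 0\<^sub>v d"
    using Tc[of "0\<^sub>v d"] by (auto simp: f_def)
  have nrm: "f x \<bullet> f x = x \<bullet> x" if "x \<in> carrier_vec d" for x
    using dist[OF that, of "0\<^sub>v d"] that fc[OF that] by (simp add: f0)
  have inner: "f x \<bullet> f y = x \<bullet> y" if xy: "x \<in> carrier_vec d" "y \<in> carrier_vec d" for x y
    using dist[OF xy] nrm[OF xy(1)] nrm[OF xy(2)]
      scalar_prod_diff_self[OF xy] scalar_prod_diff_self[OF fc[OF xy(1)] fc[OF xy(2)]]
    by simp
  define S where "S = mat_of_cols d (map (\<lambda>l. f (unit_vec d l)) [0..<d])"
  have S: "S \<in> carrier_mat d d" by (simp add: S_def mat_of_cols_def)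
  have colS: "col S l = f (unit_vec d l)" if "l < d" for l
    using that fc by (simp add: S_def)
  have SS: "transpose_mat S * S = 1\<^sub>m d"
    using S by (intro eq_matI) (auto simp: colS inner)
  have SS': "S * transpose_mat S = 1\<^sub>m d"
    using SS S by (intro mat_mult_left_right_inverse[OF _ S]) auto
  have lin: "f x = S *\<^sub>v x" if x: "x \<in> carrier_vec d" for x
  proof -
    have "transpose_mat S *\<^sub>v f x = x"
      using S x by (intro eq_vecI) (auto simp: colS inner)
    then have "S *\<^sub>v x = S *\<^sub>v (transpose_mat S *\<^sub>v f x)" by simp
    also have "\<dots> = (S * transpose_mat S) *\<^sub>v f x"
      using S fc[OF x] by (intro assoc_mult_mat_vec[symmetric]) auto
    finally show ?thesis using fc[OF x] by (simp add: SS')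
  qed
  have Tx: "T x = S *\<^sub>v x + T (0\<^sub>v d)" if x: "x \<in> carrier_vec d" for x
    using Tc[OF x] Tc[of "0\<^sub>v d"] unfolding lin[OF x, symmetric] f_def by (intro eq_vecI) auto
  show ?thesis by (rule that[OF S Tc[OF zero_carrier_vec] SS SS' Tx])
qed

lemma linear_part_eqI:
  assumes S: "S \<in> carrier_mat d d" and b: "b \<in> carrier_vec d"
    and T: "\<And>x. x \<in> carrier_vec d \<Longrightarrow> T x = S *\<^sub>v x + b"
  shows "linear_part d T = S"
  unfolding linear_part_def
proof (rule the_equality)
  show "S \<in> carrier_mat d d \<and> (\<exists>b\<in>carrier_vec d. \<forall>x\<in>carrier_vec d. T x = S *\<^sub>v x + b)"
    using assms by blast
next
  fix S' assume "S' \<in> carrier_mat d d \<and> (\<exists>b\<in>carrier_vec d. \<forall>x\<in>carrier_vec d. T x = S' *\<^sub>v x + b)"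
  then obtain b' where S': "S' \<in> carrier_mat d d" and b': "b' \<in> carrier_vec d"
    and T': "\<And>x. x \<in> carrier_vec d \<Longrightarrow> T x = S' *\<^sub>v x + b'" by blast
  have eq: "S' *\<^sub>v x + b' = S *\<^sub>v x + b" if "x \<in> carrier_vec d" for x
    using T[OF that] T'[OF that] by simp
  have "S' *\<^sub>v 0\<^sub>v d = 0\<^sub>v d" "S *\<^sub>v 0\<^sub>v d = 0\<^sub>v d"
    using S S' by (auto intro!: eq_vecI)
  then have bb: "b' = b" using eq[of "0\<^sub>v d"] b b' by simp
  show "S' = S"
  proof (rule eq_matI)
    fix i j assume ij: "i < dim_row S" "j < dim_col S"
    have "(S' *\<^sub>v unit_vec d j + b') $ i = (S *\<^sub>v unit_vec d j + b) $ i"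
      by (simp add: eq)
    then show "S' $$ (i, j) = S $$ (i, j)"
      using ij S S' b b' bb by simp
  qed (use S S' in auto)
qed

lemma linear_part_isometry:
  assumes "isometry d T"
  shows "linear_part d T \<in> carrier_mat d d"
    and "transpose_mat (linear_part d T) * linear_part d T = 1\<^sub>m d"
    and "\<exists>b\<in>carrier_vec d. \<forall>x\<in>carrier_vec d. T x = linear_part d T *\<^sub>v x + b"
proof -
  obtain S b where S: "S \<in> carrier_mat d d" and b: "b \<in> carrier_vec d"
    and SS: "transpose_mat S * S = 1\<^sub>m d"
    and Tx: "\<And>x. x \<in> carrier_vec d \<Longrightarrow> T x = S *\<^sub>v x + b"
    using isometry_affine[OF assms] by blast
  have eq: "linear_part d T = S" by (rule linear_part_eqI[OF S b Tx])
  show "linear_part d T \<in> carrier_mat d d"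
    and "transpose_mat (linear_part d T) * linear_part d T = 1\<^sub>m d"
    and "\<exists>b\<in>carrier_vec d. \<forall>x\<in>carrier_vec d. T x = linear_part d T *\<^sub>v x + b"
    unfolding eq using S SS b Tx by blast+
qed

lemma isometry_bij:
  assumes T: "isometry d T"
  shows "bij_betw T (carrier_vec d) (carrier_vec d)"
proof -
  obtain S b where S: "S \<in> carrier_mat d d" and b: "b \<in> carrier_vec d"
    and SS: "transpose_mat S * S = 1\<^sub>m d" "S * transpose_mat S = 1\<^sub>m d"
    and Tx: "\<And>x. x \<in> carrier_vec d \<Longrightarrow> T x = S *\<^sub>v x + b"
    using isometry_affine[OF T] by blast
  define U where "U y = transpose_mat S *\<^sub>v (y - b)" for y
  have U: "U y \<in> carrier_vec d" if "y \<in> carrier_vec d" for y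
    using S b that unfolding U_def by (intro mult_mat_vec_carrier[of _ d d]) auto
  show ?thesis
  proof (rule bij_betw_byWitness[where f' = U])
    show "\<forall>x\<in>carrier_vec d. U (T x) = x"
    proof
      fix x :: "real vec" assume x: "x \<in> carrier_vec d"
      have "S *\<^sub>v x + b - b = S *\<^sub>v x" using S b x by (intro eq_vecI) auto
      then have "U (T x) = transpose_mat S *\<^sub>v (S *\<^sub>v x)" unfolding U_def Tx[OF x] by simp
      also have "\<dots> = (transpose_mat S * S) *\<^sub>v x"
        using S x by (intro assoc_mult_mat_vec[symmetric]) auto
      finally show "U (T x) = x" using x by (simp add: SS)
    qed
    show "\<forall>y\<in>carrier_vec d. T (U y) = y"
    proof
      fix y :: "real vec" assume y: "y \<in> carrier_vec d"
      have "S *\<^sub>v U y = (S * transpose_mat S) *\<^sub>v (y - b)"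
        unfolding U_def using S b y by (intro assoc_mult_mat_vec[symmetric]) auto
      then have "S *\<^sub>v U y = y - b" using b y by (simp add: SS)
      moreover have "y - b + b = y" using b y by (intro eq_vecI) auto
      ultimately show "T (U y) = y" by (simp add: Tx[OF U[OF y]])
    qed
    show "T ` carrier_vec d \<subseteq> carrier_vec d" using T by (auto simp: isometry_def)
    show "U ` carrier_vec d \<subseteq> carrier_vec d" using U by auto
  qed
qed

lemma group_spatial_symmetry_group:
  assumes p: "\<forall>i<n. p i \<in> carrier_vec d"
  shows "group (spatial_symmetry_group d n es p)" (is "group ?G")
proof (rule groupI)
  let ?C = "carrier_vec d :: real vec set"
  have lt: "\<sigma> i < n" if "\<sigma> permutes {..<n}" "i < n" for \<sigma> i
    using permutes_in_image[OF that(1), of i] that(2) by simp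
  show "\<one>\<^bsub>?G\<^esub> \<in> carrier ?G"
    using p by (auto simp: spatial_symmetry_group_def spatial_symmetry_def graph_automorphism_def
        isometry_def permutes_id)
  fix x assume x: "x \<in> carrier ?G"
  obtain \<sigma> T where x': "x = (\<sigma>, T)" by force
  have \<sigma>: "\<sigma> permutes {..<n}"
    and aut: "\<And>i j. i < n \<Longrightarrow> j < n \<Longrightarrow> {\<sigma> i, \<sigma> j} \<in> set es \<longleftrightarrow> {i, j} \<in> set es"
    and T: "isometry d T" "T \<in> extensional ?C" and eff: "\<And>i. i < n \<Longrightarrow> p (\<sigma> i) = T (p i)"
    using x by (auto simp: x' spatial_symmetry_group_def spatial_symmetry_def graph_automorphism_def)
  have TC: "T \<in> ?C \<rightarrow> ?C" using T by (auto simp: isometry_def)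
  show "\<one>\<^bsub>?G\<^esub> \<otimes>\<^bsub>?G\<^esub> x = x"
    using Id_compose[OF TC T(2)] by (simp add: spatial_symmetry_group_def x')
  note bij = isometry_bij[OF T(1)]
  define U where "U = restrict (inv_into ?C T) ?C"
  have UC: "U y \<in> ?C" and TU: "T (U y) = y" if "y \<in> ?C" for y
    using bij_betw_inv_into[OF bij] bij_betw_inv_into_right[OF bij that] that
    by (auto simp: U_def bij_betw_def)
  have UT: "U (T y) = y" if "y \<in> ?C" for y
    using bij_betw_inv_into_left[OF bij that] TC that by (auto simp: U_def)
  define \<sigma>' where "\<sigma>' = inv_into UNIV \<sigma>"
  have "isometry d U"
    unfolding isometry_def
  proof (intro conjI ballI)
    fix y z :: "real vec" assume yz: "y \<in> ?C" "z \<in> ?C"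
    have "vec_dist (T (U y)) (T (U z)) = vec_dist (U y) (U z)"
      using T(1) UC yz unfolding isometry_def by blast
    then show "vec_dist (U y) (U z) = vec_dist y z" using TU yz by simp
  qed (use UC in auto)
  moreover have \<sigma>': "\<sigma>' permutes {..<n}" unfolding \<sigma>'_def using \<sigma> by (rule permutes_inv)
  moreover have "{\<sigma>' i, \<sigma>' j} \<in> set es \<longleftrightarrow> {i, j} \<in> set es" if "i < n" "j < n" for i j
    using aut[OF lt[OF \<sigma>' that(1)] lt[OF \<sigma>' that(2)]] by (simp add: permutes_inverses[OF \<sigma>] \<sigma>'_def)
  moreover have "p (\<sigma>' i) = U (p i)" if "i < n" for i
    using eff[OF lt[OF \<sigma>' that]] UT p lt[OF \<sigma>' that] by (simp add: permutes_inverses[OF \<sigma>] \<sigma>'_def)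
  ultimately have "(\<sigma>', U) \<in> carrier ?G"
    by (simp add: spatial_symmetry_group_def spatial_symmetry_def graph_automorphism_def U_def)
  moreover have "(\<sigma>', U) \<otimes>\<^bsub>?G\<^esub> x = \<one>\<^bsub>?G\<^esub>"
    using UT permutes_inv_o[OF \<sigma>]
    by (auto simp: \<sigma>'_def spatial_symmetry_group_def x' compose_def restrict_def)
  ultimately show "\<exists>y\<in>carrier ?G. y \<otimes>\<^bsub>?G\<^esub> x = \<one>\<^bsub>?G\<^esub>" by blast
  fix y assume y: "y \<in> carrier ?G"
  obtain \<tau> V where y': "y = (\<tau>, V)" by force
  have \<tau>: "\<tau> permutes {..<n}"
    and aut': "\<And>i j. i < n \<Longrightarrow> j < n \<Longrightarrow> {\<tau> i, \<tau> j} \<in> set es \<longleftrightarrow> {i, j} \<in> set es"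
    and V: "isometry d V" "V \<in> extensional ?C" and eff': "\<And>i. i < n \<Longrightarrow> p (\<tau> i) = V (p i)"
    using y by (auto simp: y' spatial_symmetry_group_def spatial_symmetry_def graph_automorphism_def)
  have VC: "V \<in> ?C \<rightarrow> ?C" using V by (auto simp: isometry_def)
  have "isometry d (compose ?C T V)"
    using T(1) V(1) by (auto simp: isometry_def compose_def Pi_iff)
  then show "x \<otimes>\<^bsub>?G\<^esub> y \<in> carrier ?G"
    using permutes_compose[OF \<tau> \<sigma>] aut aut' lt[OF \<tau>] lt[OF \<sigma>] eff eff' p
    by (auto simp: spatial_symmetry_group_def spatial_symmetry_def graph_automorphism_def x' y'
        compose_def)
  fix z assume "z \<in> carrier ?G"
  then obtain \<upsilon> W where z': "z = (\<upsilon>, W)" and W: "W \<in> ?C \<rightarrow> ?C"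
    by (auto simp: spatial_symmetry_group_def spatial_symmetry_def isometry_def)
  show "x \<otimes>\<^bsub>?G\<^esub> y \<otimes>\<^bsub>?G\<^esub> z = x \<otimes>\<^bsub>?G\<^esub> (y \<otimes>\<^bsub>?G\<^esub> z)"
    using W VC by (simp add: spatial_symmetry_group_def x' y' z' compose_assoc comp_assoc)
qed

end

theory Submission
  imports Defs
begin

text \<open>
  Both parts are one intertwining relation, \<open>R \<sigma>\<^sub>v S~ = \<sigma>\<^sub>e R\<close> with \<open>S~\<close> the direct sum of copies
  of \<open>S\<close>, multiplied on the left by a left inverse of \<open>\<sigma>\<^sub>e\<close>. Every row of \<open>R\<close> belongs to an edge
  \<open>{\<sigma> i, \<sigma> j}\<close>, the image of an edge \<open>{i, j}\<close>. On the left its block for the vertex \<open>i\<close> is the row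
  vector \<open>(p\<^bsub>\<sigma> i\<^esub> - p\<^bsub>\<sigma> j\<^esub>)\<^sup>t S\<close>. Since \<open>T\<close> is affine with
  linear part \<open>S\<close>, its translation cancels in the difference of points, and what is left is
  \<open>(S (p\<^sub>i - p\<^sub>j))\<^sup>t S = (p\<^sub>i - p\<^sub>j)\<^sup>t\<close> because \<open>S\<close> is orthogonal. This is the block for \<open>i\<close>
  in the row of \<open>R\<close> for \<open>{i, j}\<close>, which is the row that \<open>\<sigma>\<^sub>e\<close> moves to position \<open>{\<sigma> i, \<sigma> j}\<close>.
  The relation is \<open>rigidity_matrix_intertwines\<close>.

  The operator \<open>\<sigma>\<^sub>v S~\<close> is the Kronecker product of the permutation matrix of \<open>\<sigma>\<close> with \<open>S\<close>,
  by the mixed-product rule, so the two parts differ only in how the left inverse of \<open>\<sigma>\<^sub>e\<close> is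
  written. That the matrices \<open>\<sigma>\<^sub>e\<close> multiply like the automorphisms
  (\<open>edge_perm_mat_compose\<close>) supplies it in both cases.
\<close>

section \<open>Kronecker products\<close>

lemma sum_div_mod:
  fixes F :: "nat \<Rightarrow> nat \<Rightarrow> 'a::comm_monoid_add"
  shows "(\<Sum>c<n * d. F (c div d) (c mod d)) = (\<Sum>u<n. \<Sum>l<d. F u l)"
proof -
  have "(\<Sum>c<n * d. F (c div d) (c mod d))
      = (\<Sum>u<n. \<Sum>c\<in>{u * d..<u * d + d}. F (c div d) (c mod d))"
    by (rule sum.nat_group[symmetric])
  also have "\<dots> = (\<Sum>u<n. \<Sum>l<d. F u l)"
  proof (rule sum.cong[OF refl])
    fix u
    have "(\<Sum>c\<in>{u * d..<u * d + d}. F (c div d) (c mod d))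
        = (\<Sum>l\<in>{0..<d}. F ((l + u * d) div d) ((l + u * d) mod d))"
      using sum.shift_bounds_nat_ivl[of "\<lambda>c. F (c div d) (c mod d)" 0 "u * d" d]
      by (simp add: add.commute)
    also have "\<dots> = (\<Sum>l<d. F u l)"
      by (rule sum.cong) auto
    finally show "(\<Sum>c\<in>{u * d..<u * d + d}. F (c div d) (c mod d)) = (\<Sum>l<d. F u l)" .
  qed
  finally show ?thesis .
qed

lemma div_mod_less_mult:
  fixes c n d :: nat
  assumes "c < n * d"
  shows "c div d < n" and "c mod d < d"
  using assms by (auto simp: less_mult_imp_div_less intro!: mod_less_divisor Nat.gr0I)

lemma kronecker_carrier:
  assumes "A \<in> carrier_mat m n" "B \<in> carrier_mat k l"
  shows "kronecker A B \<in> carrier_mat (m * k) (n * l)"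
  using assms by (auto simp: kronecker_def)

lemma kronecker_index:
  assumes "A \<in> carrier_mat m n" "B \<in> carrier_mat k l" "r < m * k" "c < n * l"
  shows "kronecker A B $$ (r, c) = A $$ (r div k, c div l) * B $$ (r mod k, c mod l)"
  using assms by (auto simp: kronecker_def)

lemma mult_mat_index_sum:
  assumes "A \<in> carrier_mat m n" "B \<in> carrier_mat n k" "r < m" "c < k"
  shows "(A * B) $$ (r, c) = (\<Sum>s<n. A $$ (r, s) * B $$ (s, c))"
  using assms by (auto simp: scalar_prod_def atLeast0LessThan)

text \<open>The mixed-product rule: the sum over the middle index factors along quotient and remainder.\<close>

lemma kronecker_mult:
  assumes A: "A \<in> carrier_mat m n" and B: "B \<in> carrier_mat k l"
    and C: "C \<in> carrier_mat n q" and D: "D \<in> carrier_mat l s"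
  shows "kronecker A B * kronecker C D = kronecker (A * C) (B * D)"
proof (rule eq_matI)
  note AB = kronecker_carrier[OF A B] and CD = kronecker_carrier[OF C D]
  have AC: "A * C \<in> carrier_mat m q" and BD: "B * D \<in> carrier_mat k s"
    using assms by auto
  note K = kronecker_carrier[OF AC BD]
  show "dim_row (kronecker A B * kronecker C D) = dim_row (kronecker (A * C) (B * D))"
    and "dim_col (kronecker A B * kronecker C D) = dim_col (kronecker (A * C) (B * D))"
    using AB CD K by auto
  fix r c
  assume "r < dim_row (kronecker (A * C) (B * D))" "c < dim_col (kronecker (A * C) (B * D))"
  then have r: "r < m * k" and c: "c < q * s" using K by auto
  note rs = div_mod_less_mult[OF r] div_mod_less_mult[OF c]
  have "(kronecker A B * kronecker C D) $$ (r, c)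
      = (\<Sum>t<n * l. kronecker A B $$ (r, t) * kronecker C D $$ (t, c))"
    by (rule mult_mat_index_sum[OF AB CD r c])
  also have "\<dots> = (\<Sum>t<n * l. (A $$ (r div k, t div l) * B $$ (r mod k, t mod l))
      * (C $$ (t div l, c div s) * D $$ (t mod l, c mod s)))"
    by (intro sum.cong) (auto simp: kronecker_index[OF A B r] kronecker_index[OF C D _ c])
  also have "\<dots> = (\<Sum>u<n. \<Sum>v<l. (A $$ (r div k, u) * B $$ (r mod k, v))
      * (C $$ (u, c div s) * D $$ (v, c mod s)))"
    by (rule sum_div_mod)
  also have "\<dots> = (\<Sum>u<n. A $$ (r div k, u) * C $$ (u, c div s))
      * (\<Sum>v<l. B $$ (r mod k, v) * D $$ (v, c mod s))"
    by (simp add: sum_product algebra_simps)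
  also have "\<dots> = (A * C) $$ (r div k, c div s) * (B * D) $$ (r mod k, c mod s)"
    by (simp add: mult_mat_index_sum[OF A C rs(1,3)] mult_mat_index_sum[OF B D rs(2,4)])
  also have "\<dots> = kronecker (A * C) (B * D) $$ (r, c)"
    by (rule kronecker_index[OF AC BD r c, symmetric])
  finally show "(kronecker A B * kronecker C D) $$ (r, c) = kronecker (A * C) (B * D) $$ (r, c)" .
qed

lemma direct_sum_mat_eq_kronecker:
  assumes S: "S \<in> carrier_mat d d"
  shows "direct_sum_mat n S = kronecker (1\<^sub>m n) S"
proof (induction n)
  case 0
  show ?case by (intro eq_matI) (auto simp: direct_sum_mat_def kronecker_def)
next
  case (Suc n)
  let ?K = "kronecker (1\<^sub>m n) S"
  have K: "?K \<in> carrier_mat (n * d) (n * d)"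
    by (rule kronecker_carrier[OF one_carrier_mat S])
  have step: "direct_sum_mat (Suc n) S
      = four_block_mat S (0\<^sub>m d (n * d)) (0\<^sub>m (n * d) d) ?K"
    using Suc S K by (simp add: direct_sum_mat_def Let_def)
  show ?case unfolding step
  proof (rule eq_matI)
    fix r c
    assume "r < dim_row (kronecker (1\<^sub>m (Suc n)) S)" "c < dim_col (kronecker (1\<^sub>m (Suc n)) S)"
    then have r: "r < Suc n * d" and c: "c < Suc n * d"
      using S by (auto simp: kronecker_def)
    note rc = div_mod_less_mult[OF r] div_mod_less_mult[OF c]
    have shift: "x div d = Suc ((x - d) div d)" "x mod d = (x - d) mod d" if "\<not> x < d" "0 < d" for x
      using that by (auto simp: le_div_geq le_mod_geq)
    have shift_less: "x - d < n * d" "(x - d) div d < n" if "\<not> x < d" "x < Suc n * d" for x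
    proof -
      show "x - d < n * d" using that by simp
      then show "(x - d) div d < n" by (rule div_mod_less_mult)
    qed
    have d: "0 < d" using rc by linarith
    show "four_block_mat S (0\<^sub>m d (n * d)) (0\<^sub>m (n * d) d) ?K $$ (r, c)
        = kronecker (1\<^sub>m (Suc n)) S $$ (r, c)"
      unfolding kronecker_index[OF one_carrier_mat S r c]
      using S K r c rc d
      by (cases "r < d"; cases "c < d")
        (auto simp: shift shift_less kronecker_index[OF one_carrier_mat S])
  qed (use S K in \<open>auto simp: kronecker_def\<close>)
qed

section \<open>Permutation matrices of an automorphism\<close>

lemma vertex_perm_mat_eq_kronecker:
  assumes "\<sigma> permutes {..<n}"
  shows "vertex_perm_mat d n \<sigma> = kronecker (rho_n n (\<sigma>, T)) (1\<^sub>m d)"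
  by (intro eq_matI)
    (auto simp: vertex_perm_mat_def kronecker_def rho_n_def div_mod_less_mult)

lemma vertex_perm_mat_mult_direct_sum_mat:
  assumes \<sigma>: "\<sigma> permutes {..<n}" and S: "linear_part d T \<in> carrier_mat d d"
  shows "vertex_perm_mat d n \<sigma> * direct_sum_mat n (linear_part d T) = rho_v_hat d n (\<sigma>, T)"
proof -
  have P: "rho_n n (\<sigma>, T) \<in> carrier_mat n n" by (simp add: rho_n_def)
  show ?thesis
    using P S
    by (simp add: rho_v_hat_def rho_sp_def vertex_perm_mat_eq_kronecker[OF \<sigma>, of d T]
        direct_sum_mat_eq_kronecker[OF S] kronecker_mult[OF P one_carrier_mat one_carrier_mat S])
qed

lemma edge_perm_mat_carrier: "edge_perm_mat es \<sigma> \<in> carrier_mat (length es) (length es)"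
  by (simp add: edge_perm_mat_def)

lemma graph_automorphism_image_edge:
  assumes "simple_graph n es" "graph_automorphism n es \<sigma>" "e \<in> set es"
  shows "\<sigma> ` e \<in> set es"
proof -
  obtain i j where "i < n" "j < n" "e = {i, j}"
    using assms(1,3) unfolding simple_graph_def by blast
  then show ?thesis using assms(2,3) by (auto simp: graph_automorphism_def)
qed

lemma edge_perm_mat_id:
  assumes "distinct es"
  shows "edge_perm_mat es id = 1\<^sub>m (length es)"
  using assms by (intro eq_matI) (auto simp: edge_perm_mat_def nth_eq_iff_index_eq)

text \<open>
  In the sum for an entry in the column of an edge \<open>e\<close>, the nonzero terms are those whose middle index
  lists the edge \<open>\<tau> ` e\<close>. There is such an index because \<open>\<tau>\<close> preserves edges.
\<close>

lemma edge_perm_mat_compose: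
  assumes G: "simple_graph n es" and \<tau>: "graph_automorphism n es \<tau>"
  shows "edge_perm_mat es \<sigma> * edge_perm_mat es \<tau> = edge_perm_mat es (\<sigma> \<circ> \<tau>)"
proof (rule eq_matI)
  fix r c
  assume "r < dim_row (edge_perm_mat es (\<sigma> \<circ> \<tau>))" "c < dim_col (edge_perm_mat es (\<sigma> \<circ> \<tau>))"
  then have r: "r < length es" and c: "c < length es" by (auto simp: edge_perm_mat_def)
  have "\<tau> ` (es ! c) \<in> set es"
    using graph_automorphism_image_edge[OF G \<tau>] c by simp
  then obtain t where t: "t < length es" "es ! t = \<tau> ` (es ! c)"
    by (auto simp: in_set_conv_nth)
  \<comment> \<open>Edges are listed without repetition, so only the index \<open>t\<close> contributes to the sum.\<close>
  have uniq: "es ! s = \<tau> ` (es ! c) \<longleftrightarrow> s = t" if "s < length es" for s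
    using G nth_eq_iff_index_eq[OF _ that t(1)] by (simp add: simple_graph_def t(2))
  have "(edge_perm_mat es \<sigma> * edge_perm_mat es \<tau>) $$ (r, c)
      = (\<Sum>s<length es. edge_perm_mat es \<sigma> $$ (r, s) * edge_perm_mat es \<tau> $$ (s, c))"
    by (rule mult_mat_index_sum[OF edge_perm_mat_carrier edge_perm_mat_carrier r c])
  also have "\<dots> = (\<Sum>s<length es. if s = t then edge_perm_mat es \<sigma> $$ (r, s) else 0)"
    using r c by (intro sum.cong) (auto simp: uniq edge_perm_mat_def)
  also have "\<dots> = edge_perm_mat es (\<sigma> \<circ> \<tau>) $$ (r, c)"
    using r c t by (simp add: edge_perm_mat_def image_comp)
  finally show "(edge_perm_mat es \<sigma> * edge_perm_mat es \<tau>) $$ (r, c)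
      = edge_perm_mat es (\<sigma> \<circ> \<tau>) $$ (r, c)" .
qed (auto simp: edge_perm_mat_def)

lemma edge_perm_mat_left_inverse:
  assumes G: "simple_graph n es" and \<sigma>: "graph_automorphism n es \<sigma>" and "\<tau> \<circ> \<sigma> = id"
  shows "edge_perm_mat es \<tau> * edge_perm_mat es \<sigma> = 1\<^sub>m (length es)"
  using edge_perm_mat_compose[OF G \<sigma>, of \<tau>] edge_perm_mat_id[of es] assms
  by (simp add: simple_graph_def)

lemma mat_inverse_of_left_inverse:
  fixes A B :: "'a::field mat"
  assumes A: "A \<in> carrier_mat m m" and B: "B \<in> carrier_mat m m" and BA: "B * A = 1\<^sub>m m"
  shows "the (mat_inverse A) * A = 1\<^sub>m m" and "the (mat_inverse A) \<in> carrier_mat m m"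
proof -
  have "A * B = 1\<^sub>m m" by (rule mat_mult_left_right_inverse[OF B A BA])
  then have "A \<in> Units (ring_mat TYPE('a) m ())"
    using A B BA by (auto simp: Units_def ring_mat_simps)
  then have "mat_inverse A \<noteq> None" using mat_inverse(1)[OF A, of "()"] by blast
  then obtain C where "mat_inverse A = Some C" by blast
  then show "the (mat_inverse A) * A = 1\<^sub>m m" and "the (mat_inverse A) \<in> carrier_mat m m"
    using mat_inverse(2)[OF A] by auto
qed

section \<open>The rigidity matrix of a symmetric framework\<close>

lemma rigidity_matrix_carrier: "rigidity_matrix d n es p \<in> carrier_mat (length es) (n * d)"
  by (simp add: rigidity_matrix_def)

lemma rigidity_matrix_index:
  assumes "r < length es" "c < n * d" "es ! r = {i, j}" "i \<noteq> j"
  shows "rigidity_matrix d n es p $$ (r, c)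
    = (if c div d = i then (p i - p j) $ (c mod d)
       else if c div d = j then (p j - p i) $ (c mod d) else 0)"
proof -
  have "(THE w. {i, j} = {i, w}) = j" "(THE w. {i, j} = {j, w}) = i"
    using assms(4) by (auto intro!: the_equality simp: doubleton_eq_iff)
  then show ?thesis
    using assms by (auto simp: rigidity_matrix_def Let_def)
qed

text \<open>Orthogonality of the linear part, in the form in which it acts on a row of the rigidity matrix.\<close>

lemma isometry_diff_linear_part:
  assumes T: "isometry d T" and x: "x \<in> carrier_vec d" and y: "y \<in> carrier_vec d" and k: "k < d"
  shows "(\<Sum>l<d. (T x - T y) $ l * linear_part d T $$ (l, k)) = (x - y) $ k"
proof -
  define S where "S = linear_part d T"
  have S: "S \<in> carrier_mat d d" and SS: "transpose_mat S * S = 1\<^sub>m d"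
    and "\<exists>b\<in>carrier_vec d. \<forall>z\<in>carrier_vec d. T z = S *\<^sub>v z + b"
    unfolding S_def by (fact linear_part_isometry[OF T])+
  then obtain b where b: "b \<in> carrier_vec d"
    and Tz: "\<And>z. z \<in> carrier_vec d \<Longrightarrow> T z = S *\<^sub>v z + b" by blast
  have "T x - T y = S *\<^sub>v x - S *\<^sub>v y"
    unfolding Tz[OF x] Tz[OF y] using S b by (intro eq_vecI) auto
  also have "\<dots> = S *\<^sub>v (x - y)"
    using S x y by (simp add: mult_minus_distrib_mat_vec)
  finally have diff: "T x - T y = S *\<^sub>v (x - y)" .
  have "transpose_mat S *\<^sub>v (T x - T y) = (transpose_mat S * S) *\<^sub>v (x - y)"
    unfolding diff using S x y by (intro assoc_mult_mat_vec[symmetric]) auto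
  then have "transpose_mat S *\<^sub>v (T x - T y) = x - y"
    using x y by (simp add: SS)
  moreover have "(transpose_mat S *\<^sub>v (T x - T y)) $ k = (\<Sum>l<d. (T x - T y) $ l * S $$ (l, k))"
    using S k by (auto simp: scalar_prod_def diff atLeast0LessThan mult.commute)
  ultimately show ?thesis by (simp add: S_def)
qed

lemma rigidity_matrix_intertwines:
  assumes G: "simple_graph n es" and p: "\<And>i. i < n \<Longrightarrow> p i \<in> carrier_vec d"
    and sym: "spatial_symmetry d n es p \<sigma> T"
  shows "rigidity_matrix d n es p * rho_v_hat d n (\<sigma>, T)
    = edge_perm_mat es \<sigma> * rigidity_matrix d n es p"
proof (rule eq_matI)
  let ?R = "rigidity_matrix d n es p" and ?M = "rho_v_hat d n (\<sigma>, T)" and ?E = "edge_perm_mat es \<sigma>"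
  define S where "S = linear_part d T"
  have aut: "graph_automorphism n es \<sigma>" and T: "isometry d T"
    and eff: "\<And>i. i < n \<Longrightarrow> p (\<sigma> i) = T (p i)"
    using sym by (auto simp: spatial_symmetry_def)
  have \<sigma>: "\<sigma> permutes {..<n}" using aut by (simp add: graph_automorphism_def)
  have inj: "\<sigma> a = \<sigma> b \<longleftrightarrow> a = b" for a b using permutes_inj[OF \<sigma>] by (auto dest: injD)
  have S: "S \<in> carrier_mat d d" unfolding S_def by (rule linear_part_isometry(1)[OF T])
  have P: "rho_n n (\<sigma>, T) \<in> carrier_mat n n" by (simp add: rho_n_def)
  have M_eq: "?M = kronecker (rho_n n (\<sigma>, T)) S" by (simp add: rho_v_hat_def rho_sp_def S_def)
  have M: "?M \<in> carrier_mat (n * d) (n * d)" unfolding M_eq by (rule kronecker_carrier[OF P S])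
  note R = rigidity_matrix_carrier[of d n es p] and E = edge_perm_mat_carrier[of es \<sigma>]
  show "dim_row (?R * ?M) = dim_row (?E * ?R)" and "dim_col (?R * ?M) = dim_col (?E * ?R)"
    using R M E by auto
  fix r c
  assume "r < dim_row (?E * ?R)" "c < dim_col (?E * ?R)"
  then have r: "r < length es" and c: "c < n * d" using R E by auto
  define v k where "v = c div d" and "k = c mod d"
  have v: "v < n" and k: "k < d" unfolding v_def k_def by (fact div_mod_less_mult[OF c])+
  have \<sigma>v: "\<sigma> v < n" using permutes_in_image[OF \<sigma>, of v] v by simp
  \<comment> \<open>Every edge is the image of an edge, since the endpoints have preimages under \<open>\<sigma>\<close>.\<close>
  have "es ! r \<in> set es" using r by simp
  then obtain a b where ab: "a < n" "b < n" "a \<noteq> b" "es ! r = {a, b}"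
    using G unfolding simple_graph_def by blast
  obtain i j where ij: "i < n" "j < n" "a = \<sigma> i" "b = \<sigma> j"
    using ab(1,2) permutes_image[OF \<sigma>] by (metis imageE lessThan_iff)
  have "i \<noteq> j" using ab(3) ij by auto
  have "{i, j} \<in> set es"
    using aut ij \<open>es ! r \<in> set es\<close> by (auto simp: graph_automorphism_def ab(4))
  then obtain q where q: "q < length es" "es ! q = {i, j}"
    by (auto simp: in_set_conv_nth)
  have uniq: "es ! r = \<sigma> ` (es ! s) \<longleftrightarrow> s = q" if "s < length es" for s
  proof -
    have "es ! r = \<sigma> ` (es ! s) \<longleftrightarrow> es ! s = es ! q"
      using inj_image_eq_iff[OF permutes_inj[OF \<sigma>], of "es ! q" "es ! s"] by (auto simp: ab(4) ij q)
    then show ?thesis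
      using G nth_eq_iff_index_eq[OF _ that q(1)] by (simp add: simple_graph_def)
  qed
  have "(?R * ?M) $$ (r, c) = (\<Sum>t<n * d. ?R $$ (r, t) * ?M $$ (t, c))"
    by (rule mult_mat_index_sum[OF R M r c])
  \<comment> \<open>The column index is split into vertex and coordinate; only the block of \<open>\<sigma> v\<close> survives.\<close>
  also have "\<dots> = (\<Sum>t<n * d. ?R $$ (r, t div d * d + t mod d)
      * ((if t div d = \<sigma> v then 1 else 0) * S $$ (t mod d, k)))"
  proof (rule sum.cong[OF refl])
    fix t assume "t \<in> {..<n * d}"
    then have t: "t < n * d" by simp
    have "?M $$ (t, c) = (if t div d = \<sigma> v then 1 else 0) * S $$ (t mod d, k)"
      unfolding M_eq kronecker_index[OF P S t c]
      using v div_mod_less_mult(1)[OF t] by (simp add: rho_n_def v_def k_def)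
    then show "?R $$ (r, t) * ?M $$ (t, c) = ?R $$ (r, t div d * d + t mod d)
        * ((if t div d = \<sigma> v then 1 else 0) * S $$ (t mod d, k))" by simp
  qed
  also have "\<dots> = (\<Sum>u<n. \<Sum>l<d. ?R $$ (r, u * d + l) * ((if u = \<sigma> v then 1 else 0) * S $$ (l, k)))"
    by (rule sum_div_mod)
  also have "\<dots> = (\<Sum>u<n. if u = \<sigma> v then \<Sum>l<d. ?R $$ (r, u * d + l) * S $$ (l, k) else 0)"
    by (intro sum.cong) auto
  also have "\<dots> = (\<Sum>l<d. ?R $$ (r, \<sigma> v * d + l) * S $$ (l, k))"
    using \<sigma>v by simp
  also have "\<dots> = (\<Sum>l<d. (if v = i then (p (\<sigma> i) - p (\<sigma> j)) $ l
      else if v = j then (p (\<sigma> j) - p (\<sigma> i)) $ l else 0) * S $$ (l, k))"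
  proof (rule sum.cong[OF refl])
    fix l assume "l \<in> {..<d}"
    then have l: "l < d" by simp
    have "\<sigma> v * d + l < Suc (\<sigma> v) * d" using l by simp
    also have "\<dots> \<le> n * d" using \<sigma>v by (intro mult_le_mono1) simp
    finally have bound: "\<sigma> v * d + l < n * d" .
    show "?R $$ (r, \<sigma> v * d + l) * S $$ (l, k) = (if v = i then (p (\<sigma> i) - p (\<sigma> j)) $ l
        else if v = j then (p (\<sigma> j) - p (\<sigma> i)) $ l else 0) * S $$ (l, k)"
      using rigidity_matrix_index[OF r bound ab(4,3), of p] l by (simp add: ij inj)
  qed
  also have "\<dots> = (if v = i then (p i - p j) $ k else if v = j then (p j - p i) $ k else 0)"
    using isometry_diff_linear_part[OF T p[OF ij(1)] p[OF ij(2)] k]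
      isometry_diff_linear_part[OF T p[OF ij(2)] p[OF ij(1)] k]
    by (simp add: eff[OF ij(1)] eff[OF ij(2)] S_def)
  also have "\<dots> = ?R $$ (q, c)"
    using rigidity_matrix_index[OF q(1) c q(2) \<open>i \<noteq> j\<close>, of p] by (simp add: v_def k_def)
  also have "\<dots> = (\<Sum>s<length es. if s = q then ?R $$ (s, c) else 0)"
    using q by simp
  also have "\<dots> = (\<Sum>s<length es. ?E $$ (r, s) * ?R $$ (s, c))"
    using r by (intro sum.cong) (auto simp: uniq edge_perm_mat_def)
  also have "\<dots> = (?E * ?R) $$ (r, c)"
    by (rule mult_mat_index_sum[OF E R r c, symmetric])
  finally show "(?R * ?M) $$ (r, c) = (?E * ?R) $$ (r, c)" .
qed

lemma rigidity_matrix_eq_left_inverse_mult: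
  assumes G: "simple_graph n es" and p: "\<And>i. i < n \<Longrightarrow> p i \<in> carrier_vec d"
    and sym: "spatial_symmetry d n es p \<sigma> T"
    and B: "B \<in> carrier_mat (length es) (length es)"
    and BE: "B * edge_perm_mat es \<sigma> = 1\<^sub>m (length es)"
  shows "rigidity_matrix d n es p = B * rigidity_matrix d n es p * rho_v_hat d n (\<sigma>, T)"
proof -
  let ?R = "rigidity_matrix d n es p" and ?M = "rho_v_hat d n (\<sigma>, T)" and ?E = "edge_perm_mat es \<sigma>"
  note R = rigidity_matrix_carrier[of d n es p] and E = edge_perm_mat_carrier[of es \<sigma>]
  have "linear_part d T \<in> carrier_mat d d"
    using sym by (intro linear_part_isometry) (simp add: spatial_symmetry_def)
  then have M: "?M \<in> carrier_mat (n * d) (n * d)"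
    by (simp add: rho_v_hat_def rho_sp_def rho_n_def kronecker_carrier)
  have "B * ?R * ?M = B * (?E * ?R)"
    using assoc_mult_mat[OF B R M] rigidity_matrix_intertwines[OF G p sym] by simp
  also have "\<dots> = ?R"
    using assoc_mult_mat[OF B E R] BE R by simp
  finally show ?thesis by simp
qed

theorem theorem2p3:
  fixes d n :: nat and es :: "nat set list" and p :: "nat \<Rightarrow> real vec"
  assumes "framework d n es p" and "inj_on p {..<n}"
  shows
    "(\<forall>\<sigma> T. spatial_symmetry d n es p \<sigma> T \<longrightarrow>
        rigidity_matrix d n es p =
          the (mat_inverse (edge_perm_mat es \<sigma>)) * rigidity_matrix d n es p
            * vertex_perm_mat d n \<sigma> * direct_sum_mat n (linear_part d T)) \<and>
     (\<forall>g \<in> carrier (spatial_symmetry_group d n es p).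
        rigidity_matrix d n es p =
          rho_e es (inv\<^bsub>spatial_symmetry_group d n es p\<^esub> g) * rigidity_matrix d n es p
            * rho_v_hat d n g)"
proof -
  let ?R = "rigidity_matrix d n es p" and ?G = "spatial_symmetry_group d n es p"
  have G: "simple_graph n es" and p: "\<And>i. i < n \<Longrightarrow> p i \<in> carrier_vec d"
    using assms(1) by (auto simp: framework_def)
  have R: "?R \<in> carrier_mat (length es) (n * d)" by (rule rigidity_matrix_carrier)
  show ?thesis
  proof (intro conjI allI impI ballI)
    fix \<sigma> T assume sym: "spatial_symmetry d n es p \<sigma> T"
    then have aut: "graph_automorphism n es \<sigma>" and T: "isometry d T"
      by (auto simp: spatial_symmetry_def)
    then have \<sigma>: "\<sigma> permutes {..<n}" by (simp add: graph_automorphism_def)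
    have S: "linear_part d T \<in> carrier_mat d d" by (rule linear_part_isometry(1)[OF T])
    let ?B = "the (mat_inverse (edge_perm_mat es \<sigma>))"
    let ?P = "vertex_perm_mat d n \<sigma>" and ?D = "direct_sum_mat n (linear_part d T)"
    have P: "?P \<in> carrier_mat (n * d) (n * d)" by (simp add: vertex_perm_mat_def)
    have D: "?D \<in> carrier_mat (n * d) (n * d)"
      unfolding direct_sum_mat_eq_kronecker[OF S] by (rule kronecker_carrier[OF one_carrier_mat S])
    have "edge_perm_mat es (inv_into UNIV \<sigma>) * edge_perm_mat es \<sigma> = 1\<^sub>m (length es)"
      by (rule edge_perm_mat_left_inverse[OF G aut permutes_inv_o(2)[OF \<sigma>]])
    note B = mat_inverse_of_left_inverse[OF edge_perm_mat_carrier edge_perm_mat_carrier this]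
    have "?B * ?R * ?P * ?D = ?B * ?R * (?P * ?D)"
      by (rule assoc_mult_mat[OF mult_carrier_mat[OF B(2) R] P D])
    also have "\<dots> = ?B * ?R * rho_v_hat d n (\<sigma>, T)"
      by (simp add: vertex_perm_mat_mult_direct_sum_mat[OF \<sigma> S])
    finally show "?R = ?B * ?R * ?P * ?D"
      using rigidity_matrix_eq_left_inverse_mult[OF G p sym B(2,1)] by simp
  next
    fix g assume g: "g \<in> carrier ?G"
    obtain \<sigma> T where g': "g = (\<sigma>, T)" by force
    have sym: "spatial_symmetry d n es p \<sigma> T"
      using g by (simp add: g' spatial_symmetry_group_def)
    then have aut: "graph_automorphism n es \<sigma>" by (simp add: spatial_symmetry_def)
    interpret group ?G using p by (intro group_spatial_symmetry_group) simp
    obtain \<tau> U where inv: "inv\<^bsub>?G\<^esub> g = (\<tau>, U)" by force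
    have "(\<tau>, U) \<otimes>\<^bsub>?G\<^esub> (\<sigma>, T) = \<one>\<^bsub>?G\<^esub>"
      using l_inv[OF g] unfolding inv unfolding g' .
    then have "\<tau> \<circ> \<sigma> = id" by (simp add: spatial_symmetry_group_def)
    then have BE: "edge_perm_mat es \<tau> * edge_perm_mat es \<sigma> = 1\<^sub>m (length es)"
      by (rule edge_perm_mat_left_inverse[OF G aut])
    show "?R = rho_e es (inv\<^bsub>?G\<^esub> g) * ?R * rho_v_hat d n g"
      using rigidity_matrix_eq_left_inverse_mult[OF G p sym edge_perm_mat_carrier BE]
      unfolding inv by (simp add: g' rho_e_def)
  qed
qed

end
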